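(* For every integer $k\ge 1$ let $d_k(n)$ be defined by $\sum_{n=0}^\infty d_k(n)q^n=\dfrac{f_2^k}{f_1^{3k+1}}$, where $f_m:=\prod_{i=1}^\infty(1-q^{mi})$. Let $p$ be a prime and let $k\ge1$, $j\ge0$, $N\ge1$, $M\ge1$ and $r$ be integers with $1\le r\le p^M-1$. If $d_k(p^Mn+r)\equiv 0\pmod{p^N}$ for all integers $n\ge0$, then $d_{p^{M+N-1}j+k}(p^Mn+r)\equiv 0\pmod{p^N}$ for all integers $n\ge 0$.
   Context: Here $|q|<1$ and $f_m:=(q^m;q^m)_\infty=\prod_{i=1}^\infty(1-q^{mi})$. The number $d_k(n)$ counts the partitions obtained by adding the links of the $k$-elongated plane partition diamonds of length $n$; all that is needed is its generating function $\sum_{n\ge0}d_k(n)q^n=f_2^k/f_1^{3k+1}$. *)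

theory Defs
  imports
    "HOL-Analysis.Infinite_Products"
    "HOL-Computational_Algebra.Formal_Power_Series"
    "HOL-Computational_Algebra.Primes"
    "HOL-Number_Theory.Cong"
begin

text \<open>
  The generating functions are read as formal power series in \<open>q\<close> (here \<open>fps_X\<close>) with integer
  coefficients. The infinite product is taken in the metric topology of formal power series; since
  \<open>prodinf\<close> indexes from 0, the factor with index \<open>i\<close> is \<open>1 - q ^ (m * (i + 1))\<close>.
\<close>

definition euler_f :: "nat \<Rightarrow> int fps" where
  "euler_f m = (\<Prod>i. 1 - fps_X ^ (m * (i + 1)))"

lemma has_prod_euler_f:
  assumes "m \<ge> 1"
  shows "(\<lambda>i. 1 - fps_X ^ (m * (i + 1))) has_prod euler_f m"
    and euler_f_nth_0: "fps_nth (euler_f m) 0 = 1"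
proof -
  define F where "F = (\<lambda>i. 1 - fps_X ^ (m * (i + 1)) :: int fps)"
  have F0: "fps_nth (F i) 0 = 1" for i
    using assms by (simp add: F_def)
  have nz: "F i \<noteq> 0" for i
    using F0[of i] by auto
  have "subdegree (F i - 1) > n" if "i > n" for i n
  proof -
    have "F i - 1 = - (fps_X ^ (m * (i + 1)))"
      by (simp add: F_def)
    then have "subdegree (F i - 1) = m * (i + 1)"
      by (simp only: subdegree_uminus fps_X_power_subdegree)
    moreover have "1 * (i + 1) \<le> m * (i + 1)"
      using assms by (intro mult_right_mono) auto
    ultimately have "i + 1 \<le> subdegree (F i - 1)"
      by (simp only: mult_1)
    with that show ?thesis
      by linarith
  qed
  then obtain P where P: "(\<lambda>n. \<Prod>k\<le>n. F k) \<longlonglongrightarrow> P"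
    using tendsto_prod_fps[of F "\<lambda>n. n", OF nz] by blast
  have "fps_nth (\<Prod>k\<le>n. F k) 0 = 1" for n
    by (induction n) (simp_all add: F0)
  moreover have "eventually (\<lambda>n. fps_nth (\<Prod>k\<le>n. F k) 0 = fps_nth P 0) sequentially"
    using P unfolding tendsto_fps_iff by blast
  ultimately have P0: "fps_nth P 0 = 1"
    by (auto simp: eventually_sequentially)
  then have "P \<noteq> 0"
    by auto
  with P have "F has_prod P"
    by (simp add: has_prod_def raw_has_prod_def)
  moreover have "P = prodinf F"
    by (rule has_prod_unique) fact
  then have "euler_f m = P"
    unfolding euler_f_def F_def by (rule sym)
  ultimately show "(\<lambda>i. 1 - fps_X ^ (m * (i + 1))) has_prod euler_f m"
    and "fps_nth (euler_f m) 0 = 1"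
    using P0 by (simp_all add: F_def)
qed

text \<open>
  The library's \<open>inverse\<close> on power series needs an \<open>inverse\<close> operation on the coefficients, which
  \<open>int\<close> does not have. Division by \<open>euler_f 1 ^ (3 * k + 1)\<close>, whose constant coefficient is 1, is
  therefore multiplication by the two-sided inverse \<open>fps_right_inverse _ 1\<close>.
\<close>

definition d :: "nat \<Rightarrow> nat \<Rightarrow> int" where
  "d k n = fps_nth (euler_f 2 ^ k * fps_right_inverse (euler_f 1 ^ (3 * k + 1)) 1) n"

lemma generating_function_d: "Abs_fps (d k) * euler_f 1 ^ (3 * k + 1) = euler_f 2 ^ k"
proof -
  have "euler_f 1 ^ (3 * k + 1) * fps_right_inverse (euler_f 1 ^ (3 * k + 1)) 1 = 1"
    by (rule fps_right_inverse) (simp add: fps_power_zeroth euler_f_nth_0 del: One_nat_def)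
  then have "euler_f 2 ^ k * (euler_f 1 ^ (3 * k + 1) * fps_right_inverse (euler_f 1 ^ (3 * k + 1)) 1)
    = euler_f 2 ^ k"
    by (simp only: mult_1_right)
  moreover have "Abs_fps (d k) = euler_f 2 ^ k * fps_right_inverse (euler_f 1 ^ (3 * k + 1)) 1"
    by (simp add: d_def fps_eq_iff)
  ultimately show ?thesis
    by (simp only: ac_simps)
qed

end

theory Submission
  imports Defs "HOL-Number_Theory.Residues" "HOL-Computational_Algebra.Formal_Laurent_Series"
begin

text \<open>
  Passing from \<open>k\<close> to \<open>p ^ (M + N - 1) * j + k\<close> multiplies the generating function by
  \<open>G ^ (p ^ (M + N - 1) * j)\<close>, where \<open>G = f\<^sub>2 / f\<^sub>1\<^sup>3\<close>. Iterating \<open>A(q) ^ p \<equiv> A(q ^ p)\<close> modulo \<open>p\<close>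
  together with the fact that \<open>p\<close>-th powers raise the modulus from \<open>p ^ s\<close> to \<open>p ^ (s + 1)\<close>,
  one obtains \<open>G(q) ^ (p ^ (M + N - 1)) \<equiv> G(q ^ (p ^ M)) ^ (p ^ (N - 1))\<close> modulo \<open>p ^ N\<close>. So modulo
  \<open>p ^ N\<close> the extra factor is a series in \<open>q ^ (p ^ M)\<close>, and multiplying by it does not mix the residue
  classes of exponents modulo \<open>p ^ M\<close>.
\<close>

text \<open>The inner binomial coefficients are divisible by \<open>p\<close>. An arbitrary
  commutative ring is allowed so that power series are covered.\<close>

lemma prime_dvd_add_power_diff:
  fixes x y :: "'a :: comm_ring_1"
  assumes "prime p"
  shows "of_nat p dvd (x + y) ^ p - (x ^ p + y ^ p)"
proof -
  have p: "p > 0"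
    using assms by (rule prime_gt_0_nat)
  have "(x + y) ^ p = (\<Sum>i\<in>{..p}. of_nat (p choose i) * x ^ i * y ^ (p - i))"
    by (rule binomial_ring)
  also have "{..p} = insert 0 (insert p {1..<p})"
    using p by auto
  finally have "(x + y) ^ p - (x ^ p + y ^ p)
      = (\<Sum>i\<in>{1..<p}. of_nat (p choose i) * x ^ i * y ^ (p - i))"
    using p by simp
  also have "of_nat p dvd \<dots>"
  proof (rule dvd_sum)
    fix i assume "i \<in> {1..<p}"
    then have "p dvd (p choose i)"
      using assms by (intro dvd_choose_prime) auto
    then have "(of_nat p :: 'a) dvd of_nat (p choose i)"
      by (auto elim!: dvdE)
    then show "of_nat p dvd of_nat (p choose i) * x ^ i * y ^ (p - i)"
      by (simp only: mult.assoc dvd_mult2)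
  qed
  finally show ?thesis .
qed

lemma prime_dvd_sum_power_diff:
  fixes f :: "'b \<Rightarrow> 'a :: comm_ring_1"
  assumes "prime p" and "finite S"
  shows "of_nat p dvd (\<Sum>i\<in>S. f i) ^ p - (\<Sum>i\<in>S. f i ^ p)"
  using assms(2)
proof (induction S rule: finite_induct)
  case empty
  then show ?case
    using prime_gt_0_nat[OF assms(1)] by (simp add: power_0_left)
next
  case (insert a S)
  have "of_nat p dvd ((f a + sum f S) ^ p - (f a ^ p + sum f S ^ p)) + (sum f S ^ p - (\<Sum>i\<in>S. f i ^ p))"
    by (intro dvd_add insert.IH prime_dvd_add_power_diff assms(1))
  then show ?case
    using insert.hyps by (simp add: algebra_simps)
qed

lemma prime_dvd_power_diff_int:
  fixes a :: int
  assumes "prime p"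
  shows "int p dvd a ^ p - a"
proof (cases "int p dvd a")
  case True
  then show ?thesis
    using prime_gt_0_nat[OF assms] by (intro dvd_diff dvd_trans[OF True dvd_power]) auto
next
  case False
  \<comment> \<open>Fermat's little theorem is available for natural numbers, so \<open>a\<close> is
    replaced by its residue.\<close>
  define b where "b = nat (a mod int p)"
  have p: "p > 0"
    using assms by (rule prime_gt_0_nat)
  then have b: "int b = a mod int p"
    by (simp add: b_def)
  with False have "\<not> int p dvd int b"
    by (simp add: dvd_mod_iff)
  then have "\<not> p dvd b"
    by simp
  with assms have "[b ^ (p - 1) = 1] (mod p)"
    by (rule fermat_theorem)
  then have "[int b ^ (p - 1) = 1] (mod int p)"
    by (simp flip: cong_int_iff)
  moreover have "[a ^ (p - 1) = int b ^ (p - 1)] (mod int p)"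
    by (intro cong_pow) (simp add: b cong_def)
  ultimately have "[a ^ (p - 1) * a = 1 * a] (mod int p)"
    by (intro cong_mult) (auto intro: cong_trans)
  then show ?thesis
    using p by (simp add: cong_iff_dvd_diff power_eq_if[of a p] mult.commute)
qed

lemma of_nat_power_dvd_imp_dvd_fps_nth:
  fixes F :: "int fps"
  assumes "of_nat p ^ s dvd F"
  shows "int p ^ s dvd fps_nth F n"
proof -
  from assms obtain E where "F = of_nat p ^ s * E" ..
  also have "of_nat p ^ s = (fps_const (int p ^ s))"
    by (simp add: fps_of_nat fps_const_power flip: fps_const_power)
  finally show ?thesis
    by simp
qed

lemma of_nat_dvd_fpsI:
  fixes F :: "int fps"
  assumes "\<And>n. int p dvd fps_nth F n"
  shows "of_nat p dvd F"
proof
  show "F = of_nat p * Abs_fps (\<lambda>n. fps_nth F n div int p)"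
    using assms by (simp add: fps_eq_iff flip: fps_of_nat)
qed

text \<open>The additivity of \<open>p\<close>-th powers modulo \<open>p\<close> covers finite sums
  only. For the coefficient at \<open>n\<close> this suffices: \<open>A\<close> is a polynomial of
  degree at most \<open>n\<close> plus a tail whose \<open>p\<close>-th power does not reach degree
  \<open>n\<close>.\<close>

lemma prime_dvd_fps_power_diff:
  fixes A :: "int fps"
  assumes "prime p"
  shows "of_nat p dvd A ^ p - (A oo fps_X ^ p)"
proof (rule of_nat_dvd_fpsI)
  fix n
  have p: "p > 0"
    using assms by (rule prime_gt_0_nat)
  define f where "f i = fps_const (fps_nth A i) * fps_X ^ i" for i
  define B where "B = fps_shift (Suc n) A"
  have "fps_nth (f i) m = (if i = m then fps_nth A i else 0)" for i m
    by (simp add: f_def fps_X_power_nth)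
  then have A: "A = (\<Sum>i\<le>n. f i) + B * fps_X ^ Suc n"
    by (intro fps_ext) (simp add: B_def fps_sum_nth fps_X_power_mult_right_nth del: power_Suc)
  have "of_nat p dvd (A ^ p - ((\<Sum>i\<le>n. f i) ^ p + (B * fps_X ^ Suc n) ^ p))
      + ((\<Sum>i\<le>n. f i) ^ p - (\<Sum>i\<le>n. f i ^ p))"
    by (subst A) (intro dvd_add prime_dvd_add_power_diff prime_dvd_sum_power_diff assms finite_atMost)
  then have "of_nat p ^ 1 dvd A ^ p - (\<Sum>i\<le>n. f i ^ p) - (B * fps_X ^ Suc n) ^ p"
    by (simp add: algebra_simps)
  then have "int p ^ 1 dvd fps_nth (A ^ p - (\<Sum>i\<le>n. f i ^ p) - (B * fps_X ^ Suc n) ^ p) n"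
    by (rule of_nat_power_dvd_imp_dvd_fps_nth)
  moreover have "fps_nth ((B * fps_X ^ Suc n) ^ p) n = 0"
  proof -
    have "n < Suc n * p"
      using p by (cases p) auto
    then show ?thesis
      by (simp add: power_mult_distrib fps_X_power_mult_right_nth flip: power_mult del: power_Suc mult_Suc)
  qed
  ultimately have 1: "int p dvd fps_nth (A ^ p) n - (\<Sum>i\<le>n. fps_nth (f i ^ p) n)"
    by (simp add: fps_sum_nth)
  have f: "fps_nth (f i ^ p) n = (if n = i * p then fps_nth A i ^ p else 0)" for i
    by (simp add: f_def power_mult_distrib fps_const_power fps_X_power_nth flip: power_mult)
  have 2: "int p dvd (\<Sum>i\<le>n. fps_nth (f i ^ p) n) - fps_nth (A oo fps_X ^ p) n"
  \<comment> \<open>For \<open>n = m * p\<close> the sum has the single nonzero term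
    \<open>fps_nth A m ^ p\<close>, which Fermat reduces to \<open>fps_nth A m\<close>; otherwise
    both sides vanish.\<close>
  proof (cases "p dvd n")
    case True
    then obtain m where n: "n = m * p"
      by (metis dvd_def mult.commute)
    have "m \<le> n"
      using p n by simp
    then have "(\<Sum>i\<le>n. fps_nth (f i ^ p) n) = fps_nth A m ^ p"
      unfolding f unfolding n using p by simp
    then show ?thesis
      using p prime_dvd_power_diff_int[OF assms] by (simp add: fps_nth_compose_X_power n)
  next
    case False
    then have "(\<Sum>i\<le>n. fps_nth (f i ^ p) n) = 0"
      by (intro sum.neutral) (auto simp: f)
    then show ?thesis
      using False by (simp add: fps_nth_compose_X_power)
  qed
  from dvd_add[OF 1 2] show "int p dvd fps_nth (A ^ p - (A oo fps_X ^ p)) n"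
    by simp
qed

text \<open>Factor \<open>x ^ p - y ^ p\<close> as \<open>x - y\<close> times a sum of
  \<open>p\<close> products. As x and y agree modulo \<open>p\<close>, each product is congruent to
  \<open>y ^ (p - 1)\<close>, so the sum is congruent to \<open>p * y ^ (p - 1)\<close> and
  contributes the extra factor \<open>p\<close>.\<close>

lemma dvd_power_diff_lift:
  fixes x y :: "'a :: comm_ring_1"
  assumes "of_nat p ^ Suc s dvd x - y"
  shows "of_nat p ^ Suc (Suc s) dvd x ^ p - y ^ p"
proof -
  have p: "of_nat p dvd x - y"
    using assms by (auto intro: dvd_mult_left)
  have "of_nat p dvd y ^ (p - Suc i) * x ^ i - y ^ (p - 1)" if "i < p" for i
  proof -
    have "x - y dvd x ^ i - y ^ i"
      by (simp add: power_diff_sumr2)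
    with p have "of_nat p dvd y ^ (p - Suc i) * (x ^ i - y ^ i)"
      by (meson dvd_mult dvd_trans)
    moreover have "y ^ (p - Suc i) * y ^ i = y ^ (p - 1)"
      using that by (simp flip: power_add)
    ultimately show ?thesis
      by (simp add: right_diff_distrib)
  qed
  then have "of_nat p dvd (\<Sum>i<p. y ^ (p - Suc i) * x ^ i - y ^ (p - 1))"
    by (intro dvd_sum) auto
  then have "of_nat p dvd (\<Sum>i<p. y ^ (p - Suc i) * x ^ i) - of_nat p * y ^ (p - 1)"
    by (simp add: sum_subtractf)
  then have "of_nat p dvd (\<Sum>i<p. y ^ (p - Suc i) * x ^ i)"
    by (metis dvd_add_right_iff dvd_triv_left diff_add_cancel dvd_add)
  with assms have "of_nat p ^ Suc s * of_nat p dvd (x - y) * (\<Sum>i<p. y ^ (p - Suc i) * x ^ i)"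
    by (rule mult_dvd_mono)
  then show ?thesis
    by (simp only: power_diff_sumr2 power_Suc2)
qed

lemma prime_power_dvd_fps_power_diff:
  fixes A :: "int fps"
  assumes "prime p"
  shows "of_nat p ^ Suc s dvd A ^ (p ^ Suc s) - (A oo fps_X ^ p) ^ (p ^ s)"
proof (induction s)
  case 0
  show ?case
    using prime_dvd_fps_power_diff[OF assms] by simp
next
  case (Suc s)
  show ?case
    using dvd_power_diff_lift[OF Suc.IH] by (simp only: power_Suc2[of p] power_mult)
qed

text \<open>Each substitution of \<open>q ^ p\<close> for \<open>q\<close> uses up one factor
  \<open>p\<close> of the exponent. The induction needs \<open>A\<close> arbitrary, since its
  hypothesis is applied to the substituted series.\<close>

lemma prime_power_dvd_fps_power_diff_iterated:
  fixes A :: "int fps"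
  assumes "prime p"
  shows "of_nat p ^ Suc s dvd A ^ (p ^ (M + s)) - (A oo fps_X ^ (p ^ M)) ^ (p ^ s)"
proof (induction M arbitrary: A)
  case 0
  show ?case
    by simp
next
  case (Suc M)
  have p: "p > 0"
    using assms by (rule prime_gt_0_nat)
  have eq: "(A oo fps_X ^ p) oo fps_X ^ (p ^ M) = A oo fps_X ^ (p ^ Suc M)"
    using p by (simp add: mult.commute flip: fps_compose_power fps_compose_assoc power_mult)
  \<comment> \<open>A single substitution holds to the higher modulus; it is weakened to the one
    shared by all the steps.\<close>
  have "(of_nat p :: int fps) ^ Suc s dvd of_nat p ^ Suc (M + s)"
    by (rule le_imp_power_dvd) simp
  then have "of_nat p ^ Suc s dvd A ^ (p ^ Suc (M + s)) - (A oo fps_X ^ p) ^ (p ^ (M + s))"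
    using prime_power_dvd_fps_power_diff[OF assms] by (rule dvd_trans)
  from dvd_add[OF this Suc.IH[of "A oo fps_X ^ p"]] show ?case
    by (simp add: eq del: power_Suc)
qed

text \<open>Both sides agree after multiplication by a power of \<open>euler_f 1\<close>, which
  cancels because integer power series form an integral domain.\<close>

lemma generating_function_d_add:
  "Abs_fps (d (m + k)) = Abs_fps (d k) * (euler_f 2 * fps_right_inverse (euler_f 1 ^ 3) 1) ^ m"
proof -
  define I where "I = fps_right_inverse (euler_f 1 ^ 3) 1"
  have I: "euler_f 1 ^ 3 * I = 1"
    unfolding I_def
    by (rule fps_right_inverse) (simp add: fps_power_zeroth euler_f_nth_0 del: One_nat_def)
  have "3 * (m + k) + 1 = (3 * k + 1) + 3 * m"
    by simp
  then have "Abs_fps (d k) * (euler_f 2 * I) ^ m * euler_f 1 ^ (3 * (m + k) + 1)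
      = Abs_fps (d k) * (euler_f 2 * I) ^ m * (euler_f 1 ^ (3 * k + 1) * (euler_f 1 ^ 3) ^ m)"
    by (simp only: power_add power_mult)
  also have "\<dots> = (Abs_fps (d k) * euler_f 1 ^ (3 * k + 1)) * euler_f 2 ^ m * (euler_f 1 ^ 3 * I) ^ m"
    by (simp only: power_mult_distrib ac_simps)
  also have "\<dots> = Abs_fps (d (m + k)) * euler_f 1 ^ (3 * (m + k) + 1)"
    unfolding I generating_function_d by (simp add: power_add mult.commute)
  finally have "Abs_fps (d k) * (euler_f 2 * I) ^ m * euler_f 1 ^ (3 * (m + k) + 1)
      = Abs_fps (d (m + k)) * euler_f 1 ^ (3 * (m + k) + 1)" .
  moreover have "euler_f 1 \<noteq> 0"
    using euler_f_nth_0[of 1] by auto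
  ultimately show ?thesis
    by (simp add: I_def)
qed

text \<open>The second factor has only exponents divisible by \<open>m\<close>, so only coefficients
  of \<open>F\<close> at indices congruent to \<open>r\<close> modulo \<open>m\<close> enter the
  convolution.\<close>

lemma dvd_nth_mult_compose_X_power:
  fixes F H :: "int fps"
  assumes "r < m" and "\<And>n. c dvd fps_nth F (m * n + r)"
  shows "c dvd fps_nth (F * (H oo fps_X ^ m)) (m * n + r)"
  unfolding fps_mult_nth
proof (rule dvd_sum)
  fix i assume i: "i \<in> {0..m * n + r}"
  show "c dvd fps_nth F i * fps_nth (H oo fps_X ^ m) (m * n + r - i)"
  proof (cases "m dvd m * n + r - i")
    case True
    then obtain l where "m * n + r - i = m * l" ..
    with i have eq: "m * n + r = i + m * l"
      by auto
    \<comment> \<open>From \<open>r < m\<close> one gets \<open>l \<le> n\<close>, so the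
      subtraction \<open>n - l\<close> below is not truncated.\<close>
    then have "m * l < m * Suc n"
      using assms(1) by simp
    then have "l \<le> n"
      by (simp only: nat_mult_less_cancel_disj less_Suc_eq_le)
    with eq have "i = m * (n - l) + r"
      by (simp add: diff_mult_distrib2)
    then show ?thesis
      using assms(2) by simp
  next
    case False
    then show ?thesis
      using assms(1) by (simp add: fps_nth_compose_X_power)
  qed
qed

theorem theorem5p1:
  fixes p k j N M r :: nat
  assumes "prime p"
    and "k \<ge> 1" and "N \<ge> 1" and "M \<ge> 1"
    and "1 \<le> r" and "r \<le> p ^ M - 1"
    and "\<forall>n. [d k (p ^ M * n + r) = 0] (mod (int p ^ N))"
  shows "\<forall>n. [d (p ^ (M + N - 1) * j + k) (p ^ M * n + r) = 0] (mod (int p ^ N))"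
proof
  fix n
  define G where "G = euler_f 2 * fps_right_inverse (euler_f 1 ^ 3) 1"
  define m where "m = p ^ M"
  obtain s where N: "N = Suc s"
    using \<open>N \<ge> 1\<close> by (cases N) auto
  define H where "H = (G ^ (p ^ s)) ^ j"
  \<comment> \<open>If \<open>m\<close> were 0, the truncated \<open>m - 1\<close> would be 0,
    contradicting \<open>1 \<le> r\<close>.\<close>
  have m: "r < m" "m > 0"
    using \<open>1 \<le> r\<close> \<open>r \<le> p ^ M - 1\<close> unfolding m_def[symmetric] by linarith+
  have "G ^ (p ^ (M + s)) - (G oo fps_X ^ m) ^ (p ^ s)
      dvd (G ^ (p ^ (M + s))) ^ j - ((G oo fps_X ^ m) ^ (p ^ s)) ^ j"
    by (simp add: power_diff_sumr2)
  with prime_power_dvd_fps_power_diff_iterated[OF \<open>prime p\<close>]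
  have "of_nat p ^ N dvd (G ^ (p ^ (M + s))) ^ j - ((G oo fps_X ^ m) ^ (p ^ s)) ^ j"
    unfolding N m_def by (rule dvd_trans)
  \<comment> \<open>Substitution commutes with powers, so the whole extra factor is a series in
    \<open>q ^ m\<close>.\<close>
  also have "((G oo fps_X ^ m) ^ (p ^ s)) ^ j = H oo fps_X ^ m"
    using m by (simp add: H_def fps_compose_power)
  finally have "of_nat p ^ N dvd Abs_fps (d k) * ((G ^ (p ^ (M + s))) ^ j - (H oo fps_X ^ m))"
    by (rule dvd_mult)
  then have "int p ^ N dvd fps_nth (Abs_fps (d k) * ((G ^ (p ^ (M + s))) ^ j - (H oo fps_X ^ m))) (m * n + r)"
    by (rule of_nat_power_dvd_imp_dvd_fps_nth)
  moreover have "int p ^ N dvd fps_nth (Abs_fps (d k) * (H oo fps_X ^ m)) (m * n + r)"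
    using assms(7) m by (intro dvd_nth_mult_compose_X_power) (auto simp: m_def cong_0_iff)
  ultimately have "int p ^ N dvd fps_nth (Abs_fps (d k) * (G ^ (p ^ (M + s))) ^ j) (m * n + r)"
    by (simp add: right_diff_distrib dvd_diff_left_iff)
  also have "Abs_fps (d k) * (G ^ (p ^ (M + s))) ^ j = Abs_fps (d (p ^ (M + N - 1) * j + k))"
    by (simp add: generating_function_d_add G_def N power_mult)
  finally show "[d (p ^ (M + N - 1) * j + k) (p ^ M * n + r) = 0] (mod (int p ^ N))"
    by (simp add: cong_0_iff m_def)
qed

end
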